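(* Let $\boldsymbol\chi:\Omega\setminus\{O\}\to\omega$, $x=\boldsymbol\chi(X)$, be a cloaking transformation with deformation gradient $F=\nabla_X x$, $J=\det F>0$ and $V^2=FF^t$. Let $S$ be a smooth field of non-singular symmetric $d\times d$ tensors on $\omega$ satisfying $$\operatorname{div} S=0 ,$$ and define on $\omega$ $$K=J,\qquad C=K\,S\otimes S,\qquad \rho=J\,S\,V^{-2}S .$$ Then a smooth function $p$ (regarded as a function of $(X,t)$, or of $(x,t)$ through $x=\boldsymbol\chi(X)$) satisfies the uniform wave equation $$\nabla_X^2 p-\ddot p=0\quad\text{in }\Omega\setminus\{O\}$$ if and only if it satisfies $$K\,S:\nabla\big(\rho^{-1}S\,\nabla p\big)-\ddot p=0\quad\text{in }\omega ,$$ the latter being the equation for the pseudo-pressure of a pentamode material with stiffness $C$ and anisotropic inertia tensor $\rho$.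
   Context: Setting: $\Omega,\omega\subset\mathbb R^d$ are regions, $O\in\Omega$ is a point, and $\boldsymbol\chi$ is a smooth one-to-one map of $\Omega\setminus\{O\}$ onto $\omega$ with smooth inverse. $X$ denotes points of $\Omega$ and $x$ points of $\omega$. $\nabla_X$ and $\nabla_X^2$ are the gradient and Laplacian in $X$; $\nabla$, $\operatorname{div}$ are the gradient and divergence in $x$. Components: $F_{iI}=\partial x_i/\partial X_I$; $V$ is the positive definite symmetric square root of $FF^t$. For a second-order tensor field $A$, $(\operatorname{div}A)_j=\partial A_{ij}/\partial x_i$; for a vector field $w$, $A:\nabla w=A_{ij}\,\partial w_j/\partial x_i$ (summation convention). $(S\otimes S)_{ijkl}=S_{ij}S_{kl}$. A superposed dot is $\partial/\partial t$. Fields on $\Omega\setminus\{O\}$ and on $\omega$ are identified through $\boldsymbol\chi$. Pentamode material: a linear elastic material whose stiffness has the rank-one form $C=K\,S\otimes S$ with $K>0$ a scalar and $S$ a symmetric tensor. With inertia tensor $\rho$ (symmetric), velocity $v$ and strain $\varepsilon$, the pseudo-pressure is $p=-K\operatorname{tr}(S\varepsilon)$, so the stress is $\sigma=-pS$; the equations of motion are $\rho\dot v=\operatorname{div}\sigma$ and $\dot p=-K\,S:\nabla v$. Eliminating $v$ gives $K S:\nabla(\rho^{-1}\operatorname{div}(Sp))-\ddot p=0$, and when $\operatorname{div}S=0$ this reads $K S:\nabla(\rho^{-1}S\nabla p)-\ddot p=0$. *)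

theory Defs
  imports "HOL-Analysis.Analysis"
begin

text \<open>
  \<open>Ck_on k U f\<close>: \<open>f\<close> is of class \<open>C\<^sup>k\<close> on \<open>U\<close>, for open \<open>U\<close>.  The derivatives are two-sided
  (\<open>at x\<close>), so that for open \<open>U\<close> the values of \<open>f\<close> outside \<open>U\<close> are irrelevant.
\<close>

primrec Ck_on ::
  "nat \<Rightarrow> 'a::real_normed_vector set \<Rightarrow> ('a \<Rightarrow> 'b::real_normed_vector) \<Rightarrow> bool" where
  "Ck_on 0 U f \<longleftrightarrow> continuous_on U f"
| "Ck_on (Suc k) U f \<longleftrightarrow>
     (\<forall>x\<in>U. f differentiable (at x)) \<and> (\<forall>v. Ck_on k U (\<lambda>x. frechet_derivative f (at x) v))"

definition smooth_on :: "'a::real_normed_vector set \<Rightarrow> ('a \<Rightarrow> 'b::real_normed_vector) \<Rightarrow> bool" where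
  "smooth_on U f \<longleftrightarrow> (\<forall>k. Ck_on k U f)"

definition partial :: "'n::finite \<Rightarrow> (real^'n \<Rightarrow> 'b::real_normed_vector) \<Rightarrow> real^'n \<Rightarrow> 'b" where
  "partial i f x = frechet_derivative f (at x) (axis i 1)"

definition grad :: "(real^'n \<Rightarrow> real) \<Rightarrow> real^'n \<Rightarrow> real^'n" where
  "grad f x = (\<chi> i. partial i f x)"

definition laplacian :: "(real^'n \<Rightarrow> real) \<Rightarrow> real^'n \<Rightarrow> real" where
  "laplacian f x = (\<Sum>i\<in>UNIV. partial i (partial i f) x)"

text \<open>
  The divergence of a tensor field contracts the first index, and correspondingly the
  differentiation index of the gradient of a vector field is its first (row) index:
  \<open>(div A)\<^sub>j = \<partial>A\<^sub>i\<^sub>j/\<partial>x\<^sub>i\<close> and \<open>(\<nabla>w)\<^sub>i\<^sub>j = \<partial>w\<^sub>j/\<partial>x\<^sub>i\<close>.  The deformation gradient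
  \<open>F\<^sub>i\<^sub>I = \<partial>x\<^sub>i/\<partial>X\<^sub>I\<close> has the opposite index order; it is the library's \<open>jacobian\<close>.
\<close>

definition tensor_div :: "(real^'n \<Rightarrow> real^'n^'n) \<Rightarrow> real^'n \<Rightarrow> real^'n" where
  "tensor_div A x = (\<chi> j. \<Sum>i\<in>UNIV. partial i (\<lambda>y. A y $ i $ j) x)"

definition vgrad :: "(real^'n \<Rightarrow> real^'n) \<Rightarrow> real^'n \<Rightarrow> real^'n^'n" where
  "vgrad w x = (\<chi> i j. partial i (\<lambda>y. w y $ j) x)"

definition ddot :: "real^'n^'n \<Rightarrow> real^'n^'n \<Rightarrow> real" where
  "ddot A B = (\<Sum>i\<in>UNIV. \<Sum>j\<in>UNIV. A $ i $ j * B $ i $ j)"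

definition tensor_prod :: "real^'n^'n \<Rightarrow> real^'n^'n \<Rightarrow> real^'n^'n^'n^'n" where
  "tensor_prod A B = (\<chi> i j k l. A $ i $ j * B $ k $ l)"

text \<open>Hooke's law \<open>\<sigma>\<^sub>i\<^sub>j = C\<^sub>i\<^sub>j\<^sub>k\<^sub>l \<epsilon>\<^sub>k\<^sub>l\<close>.\<close>

definition stress :: "real^'n^'n^'n^'n \<Rightarrow> real^'n^'n \<Rightarrow> real^'n^'n" where
  "stress C \<epsilon> = (\<chi> i j. \<Sum>k\<in>UNIV. \<Sum>l\<in>UNIV. C $ i $ j $ k $ l * \<epsilon> $ k $ l)"

definition symmetric_tensor :: "real^'n^'n \<Rightarrow> bool" where
  "symmetric_tensor A \<longleftrightarrow> transpose A = A"

definition posdef_symmetric :: "real^'n^'n \<Rightarrow> bool" where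
  "posdef_symmetric A \<longleftrightarrow> symmetric_tensor A \<and> (\<forall>u. u \<noteq> 0 \<longrightarrow> 0 < u \<bullet> (A *v u))"

text \<open>
  A pentamode material occupying \<open>\<omega>\<close>: its stiffness has the rank-one form \<open>K S \<otimes> S\<close>.  The
  inertia tensor has to be invertible for \<open>\<rho>\<^sup>-\<^sup>1\<close> to make sense in the equation for the pseudo-pressure.
\<close>

definition pentamode_material ::
  "(real^'n) set \<Rightarrow> (real^'n \<Rightarrow> real^'n^'n^'n^'n) \<Rightarrow> (real^'n \<Rightarrow> real^'n^'n) \<Rightarrow>
   (real^'n \<Rightarrow> real) \<Rightarrow> (real^'n \<Rightarrow> real^'n^'n) \<Rightarrow> bool" where
  "pentamode_material \<omega> C \<rho> K S \<longleftrightarrow>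
     (\<forall>x\<in>\<omega>. 0 < K x \<and> symmetric_tensor (S x) \<and> C x = K x *\<^sub>R tensor_prod (S x) (S x) \<and>
        symmetric_tensor (\<rho> x) \<and> invertible (\<rho> x))"

text \<open>
  Motion of such a material with strain \<open>\<epsilon>\<close>, velocity \<open>v\<close> and pseudo-pressure \<open>p\<close> during the
  times \<open>T\<close>: \<open>p = - K tr(S\<epsilon>)\<close>, \<open>\<rho> \<partial>v/\<partial>t = div \<sigma>\<close> with \<open>\<sigma> = C\<epsilon>\<close>, and \<open>\<partial>p/\<partial>t = - K S:\<nabla>v\<close>.
\<close>

definition pentamode_motion ::
  "(real^'n) set \<Rightarrow> real set \<Rightarrow> (real^'n \<Rightarrow> real^'n^'n^'n^'n) \<Rightarrow> (real^'n \<Rightarrow> real^'n^'n) \<Rightarrow>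
   (real^'n \<Rightarrow> real) \<Rightarrow> (real^'n \<Rightarrow> real^'n^'n) \<Rightarrow>
   (real^'n \<Rightarrow> real \<Rightarrow> real^'n^'n) \<Rightarrow> (real^'n \<Rightarrow> real \<Rightarrow> real^'n) \<Rightarrow>
   (real^'n \<Rightarrow> real \<Rightarrow> real) \<Rightarrow> bool" where
  "pentamode_motion \<omega> T C \<rho> K S \<epsilon> v p \<longleftrightarrow>
     (\<forall>x\<in>\<omega>. \<forall>t\<in>T.
        symmetric_tensor (\<epsilon> x t) \<and>
        p x t = - K x * trace (S x ** \<epsilon> x t) \<and>
        \<rho> x *v vector_derivative (v x) (at t) = tensor_div (\<lambda>y. stress (C y) (\<epsilon> y t)) x \<and>
        deriv (p x) t = - K x * ddot (S x) (vgrad (\<lambda>y. v y t) x))"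

text \<open>
  The equation for the pseudo-pressure obtained by eliminating \<open>v\<close>, and the form it takes
  when \<open>div S = 0\<close>.
\<close>

definition pseudo_pressure_eq ::
  "(real^'n) set \<Rightarrow> real set \<Rightarrow> (real^'n \<Rightarrow> real) \<Rightarrow> (real^'n \<Rightarrow> real^'n^'n) \<Rightarrow>
   (real^'n \<Rightarrow> real^'n^'n) \<Rightarrow> (real^'n \<Rightarrow> real \<Rightarrow> real) \<Rightarrow> bool" where
  "pseudo_pressure_eq \<omega> T K S \<rho> p \<longleftrightarrow>
     (\<forall>x\<in>\<omega>. \<forall>t\<in>T.
        K x * ddot (S x)
          (vgrad (\<lambda>y. matrix_inv (\<rho> y) *v tensor_div (\<lambda>z. p z t *\<^sub>R S z) y) x)
        - deriv (deriv (p x)) t = 0)"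

definition reduced_pseudo_pressure_eq ::
  "(real^'n) set \<Rightarrow> real set \<Rightarrow> (real^'n \<Rightarrow> real) \<Rightarrow> (real^'n \<Rightarrow> real^'n^'n) \<Rightarrow>
   (real^'n \<Rightarrow> real^'n^'n) \<Rightarrow> (real^'n \<Rightarrow> real \<Rightarrow> real) \<Rightarrow> bool" where
  "reduced_pseudo_pressure_eq \<omega> T K S \<rho> p \<longleftrightarrow>
     (\<forall>x\<in>\<omega>. \<forall>t\<in>T.
        K x * ddot (S x)
          (vgrad (\<lambda>y. matrix_inv (\<rho> y) *v (S y *v grad (\<lambda>z. p z t) y)) x)
        - deriv (deriv (p x)) t = 0)"

definition uniform_wave_eq :: "(real^'n) set \<Rightarrow> real set \<Rightarrow> (real^'n \<Rightarrow> real \<Rightarrow> real) \<Rightarrow> bool" where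
  "uniform_wave_eq U T p \<longleftrightarrow>
     (\<forall>X\<in>U. \<forall>t\<in>T. laplacian (\<lambda>Y. p Y t) X - deriv (deriv (p X)) t = 0)"

end

theory Submission
  imports Defs
begin

text \<open>
  Since \<open>div S = 0\<close>, contracting \<open>S\<close> with \<open>\<nabla>w\<close> gives \<open>div (S w)\<close>.  For \<open>w = \<rho>\<^sup>-\<^sup>1 S \<nabla>q\<close> the factors \<open>S\<close> of
  \<open>\<rho>\<close> cancel, leaving \<open>S w = J\<^sup>-\<^sup>1 F F\<^sup>t \<nabla>q = J\<^sup>-\<^sup>1 F \<nabla>\<^sub>X p\<close>, the Piola transform of \<open>\<nabla>\<^sub>X p\<close>; its divergence is
  \<open>J\<^sup>-\<^sup>1\<close> times the Laplacian of \<open>p\<close> by the Piola identity.  That \<open>w\<close> is differentiable is seen by solving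
  for it with Cramer's rule.  For a motion of the pentamode material the stress is \<open>- q S\<close>, so the momentum
  balance gives \<open>\<partial>v/\<partial>t = - w\<close>, and the equation follows by exchanging \<open>\<partial>/\<partial>t\<close> with \<open>\<nabla>\<close>.
\<close>

section \<open>Symmetry of second derivatives\<close>

text \<open>Two passes of the mean value theorem, first along \<open>u\<close> and then along
  \<open>v\<close>. The second difference is symmetric in \<open>u\<close> and \<open>v\<close>
  while its expansion is not, which is what allows mixed derivatives to be compared.\<close>

lemma second_difference_mean_value:
  fixes f :: "'a::real_normed_vector \<Rightarrow> real"
  assumes "0 < h"
    and U: "\<And>s t. 0 \<le> s \<Longrightarrow> s \<le> h \<Longrightarrow> 0 \<le> t \<Longrightarrow> t \<le> h \<Longrightarrow> x + s *\<^sub>R u + t *\<^sub>R v \<in> U"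
    and f: "\<And>y. y \<in> U \<Longrightarrow> (f has_derivative f' y) (at y)"
    and fu: "\<And>y. y \<in> U \<Longrightarrow> ((\<lambda>y. f' y u) has_derivative f'' y) (at y)"
  obtains s t where "0 < s" "s < h" "0 < t" "t < h"
    "f (x + h *\<^sub>R u + h *\<^sub>R v) - f (x + h *\<^sub>R u) - f (x + h *\<^sub>R v) + f x
      = h * h * f'' (x + s *\<^sub>R u + t *\<^sub>R v) v"
proof -
  have line: "((\<lambda>r. g (y + r *\<^sub>R w)) has_real_derivative g' w) (at r)"
    if "(g has_derivative g') (at (y + r *\<^sub>R w))" for g :: "'a \<Rightarrow> real" and g' y w r
  proof -
    have "((\<lambda>r. g (y + r *\<^sub>R w)) has_derivative (\<lambda>k. g' (k *\<^sub>R w))) (at r)"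
      by (rule has_derivative_compose[where f = "\<lambda>r. y + r *\<^sub>R w" and g = g, OF _ that])
        (auto intro!: derivative_eq_intros)
    moreover have "(\<lambda>k. g' (k *\<^sub>R w)) = (\<lambda>k. g' w * k)"
      using linear_cmul[OF has_derivative_linear[OF that]] by (simp add: mult.commute)
    ultimately show ?thesis
      by (simp add: has_field_derivative_def)
  qed
  \<comment> \<open>The second difference is the increment between \<open>s = 0\<close> and
    \<open>s = h\<close> of \<open>f (x + h *\<^sub>R v + s *\<^sub>R u) - f (x + s *\<^sub>R
    u)\<close>.\<close>
  have "\<exists>s>0. s < h \<and>
      (f (x + h *\<^sub>R v + h *\<^sub>R u) - f (x + h *\<^sub>R u)) - (f (x + h *\<^sub>R v + 0 *\<^sub>R u) - f (x + 0 *\<^sub>R u))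
      = (h - 0) * (f' (x + h *\<^sub>R v + s *\<^sub>R u) u - f' (x + s *\<^sub>R u) u)"
  proof (rule MVT2[OF \<open>0 < h\<close>])
    fix s assume s: "0 \<le> s" "s \<le> h"
    have "x + h *\<^sub>R v + s *\<^sub>R u \<in> U" "x + s *\<^sub>R u \<in> U"
      using U[OF s, of h] U[OF s, of 0] \<open>0 < h\<close> by (auto simp: ac_simps)
    then show "((\<lambda>s. f (x + h *\<^sub>R v + s *\<^sub>R u) - f (x + s *\<^sub>R u)) has_real_derivative
        f' (x + h *\<^sub>R v + s *\<^sub>R u) u - f' (x + s *\<^sub>R u) u) (at s)"
      by (intro DERIV_diff line f)
  qed
  then obtain s where s: "0 < s" "s < h"
    "(f (x + h *\<^sub>R v + h *\<^sub>R u) - f (x + h *\<^sub>R u)) - (f (x + h *\<^sub>R v) - f x)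
      = h * (f' (x + h *\<^sub>R v + s *\<^sub>R u) u - f' (x + s *\<^sub>R u) u)"
    by auto
  \<comment> \<open>What remains is again an increment, now along \<open>v\<close>, of the
    directional derivative in direction \<open>u\<close>.\<close>
  have "\<exists>t>0. t < h \<and> f' (x + s *\<^sub>R u + h *\<^sub>R v) u - f' (x + s *\<^sub>R u + 0 *\<^sub>R v) u
      = (h - 0) * f'' (x + s *\<^sub>R u + t *\<^sub>R v) v"
    by (rule MVT2[OF \<open>0 < h\<close>], rule line, rule fu, rule U) (use s in auto)
  then obtain t where "0 < t" "t < h"
    "f' (x + s *\<^sub>R u + h *\<^sub>R v) u - f' (x + s *\<^sub>R u) u = h * f'' (x + s *\<^sub>R u + t *\<^sub>R v) v"
    by auto
  with s show ?thesis
    by (intro that[of s t]) (simp_all add: ac_simps)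
qed

text \<open>The same second difference, expanded with \<open>u\<close> first and with
  \<open>v\<close> first, gives equal values of the two mixed derivatives at two points near
  \<open>x\<close>. Continuity at \<open>x\<close> then excludes a gap between them.\<close>

lemma second_derivative_symmetric_real:
  fixes f :: "'a::real_normed_vector \<Rightarrow> real"
  assumes "open U" "x \<in> U"
    and f: "\<And>y. y \<in> U \<Longrightarrow> (f has_derivative f' y) (at y)"
    and fu: "\<And>y. y \<in> U \<Longrightarrow> ((\<lambda>y. f' y u) has_derivative fu y) (at y)"
    and fv: "\<And>y. y \<in> U \<Longrightarrow> ((\<lambda>y. f' y v) has_derivative fv y) (at y)"
    and cu: "continuous_on U (\<lambda>y. fu y v)"
    and cv: "continuous_on U (\<lambda>y. fv y u)"
  shows "fu x v = fv x u"
proof (rule ccontr)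
  assume ne: "fu x v \<noteq> fv x u"
  \<comment> \<open>Half of the gap: a single number cannot be closer than \<open>e\<close> to both
    values.\<close>
  define e where "e = \<bar>fu x v - fv x u\<bar> / 2"
  have "0 < e" using ne by (simp add: e_def)
  obtain d0 where d0: "0 < d0" "ball x d0 \<subseteq> U"
    using \<open>open U\<close> \<open>x \<in> U\<close> open_contains_ball by blast
  obtain d1 where d1: "0 < d1" "\<And>y. y \<in> U \<Longrightarrow> dist y x < d1 \<Longrightarrow> dist (fu y v) (fu x v) < e"
    using cu \<open>x \<in> U\<close> \<open>0 < e\<close> unfolding continuous_on_iff by blast
  obtain d2 where d2: "0 < d2" "\<And>y. y \<in> U \<Longrightarrow> dist y x < d2 \<Longrightarrow> dist (fv y u) (fv x u) < e"
    using cv \<open>x \<in> U\<close> \<open>0 < e\<close> unfolding continuous_on_iff by blast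
  define d where "d = min d0 (min d1 d2)"
  \<comment> \<open>The summand \<open>1\<close> keeps the denominator positive when
    \<open>u\<close> and \<open>v\<close> both vanish, and makes the bound in \<open>near\<close>
    strict.\<close>
  define h where "h = d / (norm u + norm v + 1)"
  have "0 < d" using d0 d1 d2 by (simp add: d_def)
  have pos: "norm u + norm v + 1 > 0"
    using norm_ge_zero[of u] norm_ge_zero[of v] by linarith
  have "0 < h" using \<open>0 < d\<close> pos by (simp add: h_def)
  have near: "dist (x + s *\<^sub>R u + t *\<^sub>R v) x < d" if "0 \<le> s" "s \<le> h" "0 \<le> t" "t \<le> h" for s t
  proof -
    have "dist (x + s *\<^sub>R u + t *\<^sub>R v) x \<le> norm (s *\<^sub>R u) + norm (t *\<^sub>R v)"
      by (simp add: dist_norm add.assoc norm_triangle_ineq del: norm_scaleR)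
    also have "\<dots> \<le> h * norm u + h * norm v"
      using that by (intro add_mono) (auto intro: mult_right_mono)
    also have "\<dots> < h * (norm u + norm v + 1)"
      using \<open>0 < h\<close> by (simp add: algebra_simps)
    also have "\<dots> = d" using pos by (simp add: h_def)
    finally show ?thesis .
  qed
  have inU: "x + s *\<^sub>R u + t *\<^sub>R v \<in> U" if "0 \<le> s" "s \<le> h" "0 \<le> t" "t \<le> h" for s t
    using near[OF that] d0 by (auto simp: d_def dist_commute)
  have inU': "x + t *\<^sub>R v + s *\<^sub>R u \<in> U" if "0 \<le> t" "t \<le> h" "0 \<le> s" "s \<le> h" for s t
    using inU[of s t] that by (simp add: ac_simps)
  obtain s t where 1: "0 < s" "s < h" "0 < t" "t < h"
    "f (x + h *\<^sub>R u + h *\<^sub>R v) - f (x + h *\<^sub>R u) - f (x + h *\<^sub>R v) + f x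
      = h * h * fu (x + s *\<^sub>R u + t *\<^sub>R v) v"
    by (rule second_difference_mean_value[OF \<open>0 < h\<close> inU f fu])
  obtain s' t' where 2: "0 < s'" "s' < h" "0 < t'" "t' < h"
    "f (x + h *\<^sub>R v + h *\<^sub>R u) - f (x + h *\<^sub>R v) - f (x + h *\<^sub>R u) + f x
      = h * h * fv (x + t' *\<^sub>R v + s' *\<^sub>R u) u"
    by (rule second_difference_mean_value[OF \<open>0 < h\<close> inU' f fv])
  have swap: "x + c *\<^sub>R v + r *\<^sub>R u = x + r *\<^sub>R u + c *\<^sub>R v" for r c by simp
  have "h * h * fu (x + s *\<^sub>R u + t *\<^sub>R v) v = h * h * fv (x + s' *\<^sub>R u + t' *\<^sub>R v) u"
    using 1(5) 2(5)[unfolded swap] by linarith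
  then have eq: "fu (x + s *\<^sub>R u + t *\<^sub>R v) v = fv (x + s' *\<^sub>R u + t' *\<^sub>R v) u"
    using \<open>0 < h\<close> by simp
  have "dist (fu (x + s *\<^sub>R u + t *\<^sub>R v) v) (fu x v) < e"
    using 1 inU[of s t] near[of s t] by (intro d1) (auto simp: d_def)
  moreover have "dist (fv (x + s' *\<^sub>R u + t' *\<^sub>R v) u) (fv x u) < e"
    using 2 inU[of s' t'] near[of s' t'] by (intro d2) (auto simp: d_def)
  ultimately show False
    using eq ne by (auto simp: e_def dist_real_def abs_if split: if_splits)
qed

text \<open>Pairing with each fixed \<open>b\<close> reduces this to the real-valued case.\<close>

lemma second_derivative_symmetric:
  fixes f :: "'a::real_normed_vector \<Rightarrow> 'b::real_inner"
  assumes "open U" "x \<in> U"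
    and f: "\<And>y. y \<in> U \<Longrightarrow> (f has_derivative f' y) (at y)"
    and fu: "\<And>y. y \<in> U \<Longrightarrow> ((\<lambda>y. f' y u) has_derivative fu y) (at y)"
    and fv: "\<And>y. y \<in> U \<Longrightarrow> ((\<lambda>y. f' y v) has_derivative fv y) (at y)"
    and cu: "continuous_on U (\<lambda>y. fu y v)"
    and cv: "continuous_on U (\<lambda>y. fv y u)"
  shows "fu x v = fv x u"
proof -
  have "fu x v \<bullet> b = fv x u \<bullet> b" for b
    by (rule second_derivative_symmetric_real[OF assms(1,2), where f = "\<lambda>y. f y \<bullet> b"
          and f' = "\<lambda>y k. f' y k \<bullet> b" and fu = "\<lambda>y k. fu y k \<bullet> b" and fv = "\<lambda>y k. fv y k \<bullet> b"])
      (auto intro!: has_derivative_inner_left f fu fv continuous_intros cu cv)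
  then show ?thesis
    by (metis inner_commute vector_eq_ldot)
qed

section \<open>Derivatives of smooth functions\<close>

lemma smooth_on_imp_has_derivative:
  assumes "smooth_on U f" "x \<in> U"
  shows "(f has_derivative frechet_derivative f (at x)) (at x)"
proof -
  have "Ck_on (Suc 0) U f" using assms(1) by (simp only: smooth_on_def)
  then show ?thesis using assms(2) by (simp add: frechet_derivative_works)
qed

lemma smooth_on_frechet_derivative:
  "smooth_on U f \<Longrightarrow> smooth_on U (\<lambda>x. frechet_derivative f (at x) v)"
  unfolding smooth_on_def by (metis Ck_on.simps(2))

lemma smooth_on_imp_continuous_on: "smooth_on U f \<Longrightarrow> continuous_on U f"
  unfolding smooth_on_def by (metis Ck_on.simps(1))

lemma smooth_on_frechet_derivative_commute:
  fixes f :: "'a::real_normed_vector \<Rightarrow> 'b::real_inner"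
  assumes "open U" "x \<in> U" "smooth_on U f"
  shows "frechet_derivative (\<lambda>y. frechet_derivative f (at y) u) (at x) v
       = frechet_derivative (\<lambda>y. frechet_derivative f (at y) v) (at x) u"
  by (rule second_derivative_symmetric[OF assms(1,2), where f = f])
    (auto intro!: smooth_on_imp_has_derivative smooth_on_frechet_derivative
      smooth_on_imp_continuous_on assms(3))

section \<open>Derivative of the determinant\<close>

lemma has_derivative_vec_nth:
  "(f has_derivative f') F \<Longrightarrow> ((\<lambda>x. f x $ i) has_derivative (\<lambda>h. f' h $ i)) F"
  by (rule bounded_linear.has_derivative[OF bounded_linear_vec_nth])

text \<open>Differentiating the Leibniz formula removes one factor from each product. A permutation
  other than the identity moves at least two indices, so at the identity matrix a vanishing
  off-diagonal factor survives; only the diagonal product contributes.\<close>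

lemma has_derivative_det_at_mat_1:
  fixes A :: "'a::real_normed_vector \<Rightarrow> real^'n^'n"
  assumes A: "\<And>i j. ((\<lambda>y. A y $ i $ j) has_derivative A' i j) (at x)"
    and "A x = mat 1"
  shows "((\<lambda>y. det (A y)) has_derivative (\<lambda>h. \<Sum>i\<in>UNIV. A' i i h)) (at x)"
proof -
  let ?P = "{p. p permutes (UNIV::'n set)}"
  let ?d = "\<lambda>p h. \<Sum>i\<in>UNIV. A' i (p i) h * (\<Prod>j\<in>UNIV - {i}. A x $ j $ p j)"
  have "((\<lambda>y. det (A y)) has_derivative (\<lambda>h. \<Sum>p\<in>?P. of_int (sign p) * ?d p h)) (at x)"
    unfolding det_def by (intro has_derivative_sum has_derivative_mult_right has_derivative_prod A)
  moreover have "(\<Sum>p\<in>?P. of_int (sign p) * ?d p h) = (\<Sum>i\<in>UNIV. A' i i h)" for h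
  proof -
    have "?d p h = 0" if p: "p \<in> ?P - {id}" for p
    proof (rule sum.neutral, rule ballI)
      fix i
      obtain k where k: "p k \<noteq> k" using p by (auto simp: fun_eq_iff)
      \<comment> \<open>By injectivity \<open>p k\<close> is a second moved index, so one differs
        from the omitted index \<open>i\<close>.\<close>
      have "p (p k) \<noteq> p k"
        using p k permutes_inj[of p UNIV] by (auto simp: inj_eq)
      with k obtain j where "j \<noteq> i" "p j \<noteq> j" by metis
      then have "(\<Prod>j\<in>UNIV - {i}. A x $ j $ p j) = 0"
        by (intro prod_zero) (force simp: \<open>A x = mat 1\<close> mat_def)+
      then show "A' i (p i) h * (\<Prod>j\<in>UNIV - {i}. A x $ j $ p j) = 0" by simp
    qed
    then have "(\<Sum>p\<in>?P. of_int (sign p) * ?d p h) = (\<Sum>p\<in>{id}. of_int (sign p) * ?d p h)"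
      by (intro sum.mono_neutral_right) (auto simp: finite_permutations permutes_id)
    then show ?thesis
      by (simp add: sign_id \<open>A x = mat 1\<close> mat_def)
  qed
  ultimately show ?thesis by simp
qed

text \<open>Jacobi's formula. Multiplying by the constant inverse \<open>B\<close> moves the base
  point to the identity matrix, where the derivative is a trace; the factor \<open>det (A x)\<close>
  undoes the multiplication.\<close>

lemma has_derivative_det:
  fixes A :: "'a::real_normed_vector \<Rightarrow> real^'n^'n"
  assumes A: "\<And>i j. ((\<lambda>y. A y $ i $ j) has_derivative A' i j) (at x)"
    and "A x ** B = mat 1"
  shows "((\<lambda>y. det (A y)) has_derivative
    (\<lambda>h. det (A x) * (\<Sum>i\<in>UNIV. \<Sum>j\<in>UNIV. B $ i $ j * A' j i h))) (at x)"
proof -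
  have BA: "B ** A x = mat 1"
    using assms(2) by (simp add: matrix_left_right_inverse)
  have "((\<lambda>y. det (B ** A y)) has_derivative (\<lambda>h. \<Sum>i\<in>UNIV. \<Sum>j\<in>UNIV. B $ i $ j * A' j i h)) (at x)"
    by (rule has_derivative_det_at_mat_1[where A = "\<lambda>y. B ** A y", OF _ BA, where A' = "\<lambda>i k h. \<Sum>j\<in>UNIV. B $ i $ j * A' j k h"])
      (auto simp: matrix_matrix_mult_def intro!: has_derivative_sum has_derivative_mult_right A)
  then have "((\<lambda>y. det (A x) * det (B ** A y)) has_derivative
    (\<lambda>h. det (A x) * (\<Sum>i\<in>UNIV. \<Sum>j\<in>UNIV. B $ i $ j * A' j i h))) (at x)"
    by (rule has_derivative_mult_right)
  moreover have "det (A x) * det (B ** A y) = det (A y)" for y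
    by (metis assms(2) det_mul matrix_mul_assoc matrix_mul_lid)
  ultimately show ?thesis by simp
qed

text \<open>Covers singular matrices too, such as the numerators in Cramer's rule.\<close>

lemma differentiable_det:
  fixes A :: "'a::real_normed_vector \<Rightarrow> real^'n^'n"
  assumes "\<And>i j. (\<lambda>y. A y $ i $ j) differentiable (at x)"
  shows "(\<lambda>y. det (A y)) differentiable (at x)"
proof -
  obtain A' where A: "\<And>i j. ((\<lambda>y. A y $ i $ j) has_derivative A' i j) (at x)"
    using assms unfolding differentiable_def by metis
  have "((\<lambda>y. det (A y)) has_derivative (\<lambda>h. \<Sum>p | p permutes UNIV. of_int (sign p) *
      (\<Sum>i\<in>UNIV. A' i (p i) h * (\<Prod>j\<in>UNIV - {i}. A x $ j $ p j)))) (at x)"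
    unfolding det_def by (intro has_derivative_sum has_derivative_mult_right has_derivative_prod A)
  then show ?thesis by (rule differentiableI)
qed

text \<open>By Cramer's rule each component of the solution is a quotient of determinants with
  differentiable entries.\<close>

lemma differentiable_solution:
  fixes A :: "'a::real_normed_vector \<Rightarrow> real^'n^'n"
  assumes "open U" "x \<in> U"
    and "\<And>i j. (\<lambda>y. A y $ i $ j) differentiable (at x)"
    and "\<And>i. (\<lambda>y. b y $ i) differentiable (at x)"
    and inv: "\<And>y. y \<in> U \<Longrightarrow> invertible (A y)"
    and eq: "\<And>y. y \<in> U \<Longrightarrow> A y *v w y = b y"
  shows "(\<lambda>y. w y $ k) differentiable (at x)"
proof -
  \<comment> \<open>Column \<open>k\<close> is replaced by the right-hand side, as in the numerator
    of Cramer's rule.\<close>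
  let ?B = "\<lambda>y. \<chi> i j. if j = k then b y $ i else A y $ i $ j"
  have "det (A x) \<noteq> 0" using inv[OF \<open>x \<in> U\<close>] by (simp add: invertible_det_nz)
  moreover have B: "(\<lambda>y. ?B y $ i $ j) differentiable (at x)" for i j
    by (cases "j = k") (simp_all add: assms(3,4))
  ultimately have "(\<lambda>y. det (?B y) / det (A y)) differentiable (at x)"
    by (intro differentiable_divide differentiable_det) (simp_all add: assms(3,4) B del: vec_lambda_beta)
  moreover have "det (?B y) / det (A y) = w y $ k" if "y \<in> U" for y
    using cramer[of "A y" "w y" "b y"] inv[OF that] eq[OF that] by (simp add: invertible_det_nz)
  ultimately show ?thesis
    using \<open>open U\<close> \<open>x \<in> U\<close> unfolding differentiable_def
    by (meson has_derivative_transform_within_open)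
qed

section \<open>Partial derivatives and the Piola identity\<close>

text \<open>Holds for non-differentiable functions as well: \<open>frechet_derivative\<close> is a
  choice among candidate derivatives, and both functions have the same candidates.\<close>

lemma frechet_derivative_cong_open:
  assumes "open U" "x \<in> U" "\<And>y. y \<in> U \<Longrightarrow> f y = g y"
  shows "frechet_derivative f (at x) = frechet_derivative g (at x)"
proof -
  have "(f has_derivative f') (at x) \<longleftrightarrow> (g has_derivative f') (at x)" for f'
    using assms by (metis has_derivative_transform_within_open)
  then show ?thesis by (simp add: frechet_derivative_def)
qed

lemma partial_cong:
  assumes "open U" "x \<in> U" "\<And>y. y \<in> U \<Longrightarrow> f y = g y"
  shows "partial i f x = partial i g x"
  unfolding partial_def using frechet_derivative_cong_open[OF assms] by simp

lemma partial_eqI: "(f has_derivative f') (at x) \<Longrightarrow> partial i f x = f' (axis i 1)"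
  unfolding partial_def by (metis frechet_derivative_at)

lemma has_derivative_eq_sum_partial:
  fixes f :: "real^'n \<Rightarrow> real"
  assumes "(f has_derivative f') (at x)"
  shows "f' h = (\<Sum>k\<in>UNIV. h $ k * partial k f x)"
proof -
  have "f' h = f' (\<Sum>k\<in>UNIV. (h $ k) *\<^sub>R axis k 1)"
    using basis_expansion[of h] by (simp add: scalar_mult_eq_scaleR)
  also have "\<dots> = (\<Sum>k\<in>UNIV. (h $ k) *\<^sub>R f' (axis k 1))"
    using has_derivative_linear[OF assms] by (simp add: linear_sum linear_cmul)
  finally show ?thesis by (simp add: partial_eqI[OF assms])
qed

lemma partial_mult:
  fixes f g :: "real^'n \<Rightarrow> real"
  assumes "f differentiable (at x)" "g differentiable (at x)"
  shows "partial i (\<lambda>y. f y * g y) x = f x * partial i g x + partial i f x * g x"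
  using assms unfolding frechet_derivative_works
  by (subst partial_eqI[OF has_derivative_mult]) (auto simp: partial_def)

lemma partial_sum:
  assumes "\<And>k. k \<in> I \<Longrightarrow> f k differentiable (at x)"
  shows "partial i (\<lambda>y. \<Sum>k\<in>I. f k y) x = (\<Sum>k\<in>I. partial i (f k) x)"
  using assms unfolding frechet_derivative_works
  by (subst partial_eqI[OF has_derivative_sum]) (auto simp: partial_def)

lemma partial_compose:
  fixes f :: "real^'n \<Rightarrow> real"
  assumes "f differentiable (at (g x))" "(g has_derivative g') (at x)"
  shows "partial i (\<lambda>y. f (g y)) x = (\<Sum>k\<in>UNIV. g' (axis i 1) $ k * partial k f (g x))"
proof -
  obtain f' where f': "(f has_derivative f') (at (g x))"
    using assms(1) by (auto simp: differentiable_def)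
  show ?thesis
    by (subst partial_eqI[OF has_derivative_compose[OF assms(2) f']])
      (rule has_derivative_eq_sum_partial[OF f'])
qed

text \<open>
  Jacobi's formula and the symmetry of the second derivatives of \<open>\<phi>\<close> make the contributions of the
  derivatives of \<open>det F\<close> and of \<open>F\<close> cancel.
\<close>

lemma piola_transform_divergence:
  fixes \<phi> \<psi> :: "real^'n \<Rightarrow> real^'n"
  assumes "open U" "X \<in> U" "smooth_on U \<phi>"
    and F: "\<And>Y. Y \<in> U \<Longrightarrow> F Y = jacobian \<phi> (at Y)"
    and J: "det (F X) \<noteq> 0" and FG: "F X ** G = mat 1"
    and \<psi>: "(\<psi> has_derivative (\<lambda>h. G *v h)) (at x)" "\<psi> x = X"
    and a: "\<And>k. (\<lambda>Y. a Y $ k) differentiable (at X)"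
  defines "b \<equiv> \<lambda>Y. (1 / det (F Y)) *\<^sub>R (F Y *v a Y)"
  shows "(\<lambda>y. b (\<psi> y) $ i) differentiable (at x)"
    and "(\<Sum>i\<in>UNIV. partial i (\<lambda>y. b (\<psi> y) $ i) x)
      = (1 / det (F X)) * (\<Sum>k\<in>UNIV. partial k (\<lambda>Y. a Y $ k) X)"
proof -
  \<comment> \<open>Column \<open>l\<close> of \<open>F\<close>, written as a derivative of
    \<open>\<phi>\<close> so that smoothness applies; \<open>F\<close> itself is known only on
    \<open>U\<close>.\<close>
  define D where "D l Y = frechet_derivative \<phi> (at Y) (axis l 1)" for l Y
  have FD: "F Y $ i $ l = D l Y $ i" if "Y \<in> U" for Y i l
    using that by (simp add: F jacobian_def matrix_def D_def)
  define dF where "dF i l h = frechet_derivative (D l) (at X) h $ i" for i l h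
  have dF: "((\<lambda>Y. F Y $ i $ l) has_derivative dF i l) (at X)" for i l
  proof -
    have "(D l has_derivative frechet_derivative (D l) (at X)) (at X)"
      unfolding D_def
      by (rule smooth_on_imp_has_derivative[OF smooth_on_frechet_derivative[OF assms(3)] assms(2)])
    then have "((\<lambda>Y. D l Y $ i) has_derivative dF i l) (at X)"
      unfolding dF_def by (rule has_derivative_vec_nth)
    then show ?thesis
      by (rule has_derivative_transform_within_open[OF _ \<open>open U\<close> \<open>X \<in> U\<close>]) (simp add: FD)
  qed
  \<comment> \<open>Both sides are mixed second partial derivatives of component \<open>i\<close> of
    \<open>\<phi>\<close>.\<close>
  have sym: "dF i l (axis k 1) = dF i k (axis l 1)" for i k l
    unfolding dF_def D_def using smooth_on_frechet_derivative_commute[OF assms(1-3)] by metis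
  obtain da where da: "\<And>k. ((\<lambda>Y. a Y $ k) has_derivative da k) (at X)"
    using a unfolding differentiable_def by metis
  \<comment> \<open>The logarithmic derivative of \<open>det (F Y)\<close> in direction
    \<open>h\<close>, by Jacobi's formula.\<close>
  define tr where "tr h = (\<Sum>i\<in>UNIV. \<Sum>j\<in>UNIV. G $ i $ j * dF j i h)" for h
  have dJ: "((\<lambda>Y. det (F Y)) has_derivative (\<lambda>h. det (F X) * tr h)) (at X)"
    unfolding tr_def by (rule has_derivative_det[OF dF FG])
  have b: "b Y $ i = (\<Sum>l\<in>UNIV. F Y $ i $ l * a Y $ l) * inverse (det (F Y))" for Y i
    by (simp add: b_def matrix_vector_mult_def divide_inverse mult.commute)
  \<comment> \<open>Product rule for \<open>b\<close>; the last term comes from differentiating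
    \<open>inverse (det (F Y))\<close>.\<close>
  define db where "db i h = inverse (det (F X)) *
      ((\<Sum>l\<in>UNIV. F X $ i $ l * da l h) + (\<Sum>l\<in>UNIV. dF i l h * a X $ l)
        - (\<Sum>l\<in>UNIV. F X $ i $ l * a X $ l) * tr h)" for i h
  have db: "((\<lambda>Y. b Y $ i) has_derivative db i) (at X)" for i
    unfolding b db_def
    by (rule has_derivative_eq_rhs[OF has_derivative_mult[OF
          has_derivative_sum[OF has_derivative_mult[OF dF da]] Deriv.has_derivative_inverse[OF J dJ]]])
      (simp add: J fun_eq_iff sum.distrib algebra_simps)
  have diff_b: "(\<lambda>Y. b Y $ i) differentiable (at (\<psi> x))" for i
    using differentiableI[OF db] \<psi>(2) by simp
  show "(\<lambda>y. b (\<psi> y) $ i) differentiable (at x)"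
    using differentiable_chain_at[OF differentiableI[OF \<psi>(1)] diff_b] by (simp add: o_def)
  have swap: "G $ k $ i * (dF i l (axis k 1) * a X $ l) = a X $ l * (G $ k $ i * dF i k (axis l 1))"
    for i k l by (simp add: sym[of i l k])
  have Gdb: "G $ k $ i * db i h = inverse (det (F X)) *
      (G $ k $ i * (\<Sum>l\<in>UNIV. F X $ i $ l * da l h)
        + G $ k $ i * (\<Sum>l\<in>UNIV. dF i l h * a X $ l)
        - G $ k $ i * (\<Sum>l\<in>UNIV. F X $ i $ l * a X $ l) * tr h)" for i k h
    by (simp add: db_def algebra_simps)
  have collect: "(\<Sum>i\<in>UNIV. c * (u i + v i - w i * t))
      = c * ((\<Sum>i\<in>UNIV. u i) + (\<Sum>i\<in>UNIV. v i) - (\<Sum>i\<in>UNIV. w i) * t)"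
    for c t and u v w :: "'n \<Rightarrow> real"
    by (simp add: sum.distrib sum_subtractf flip: sum_distrib_left sum_distrib_right)
  have GF: "(\<Sum>i\<in>UNIV. G $ k $ i * F X $ i $ l) = (if k = l then 1 else 0)" for k l
  proof -
    have "G ** F X = mat 1" using FG by (simp add: matrix_left_right_inverse)
    then show ?thesis by (simp add: matrix_matrix_mult_def mat_def vec_eq_iff)
  qed
  \<comment> \<open>Since \<open>G\<close> inverts \<open>F X\<close>, this extracts the divergence
    of \<open>a\<close> from the terms with \<open>da\<close>, and \<open>a X $ k\<close> from the
    terms with \<open>tr\<close>.\<close>
  have contract: "(\<Sum>i\<in>UNIV. G $ k $ i * (\<Sum>l\<in>UNIV. F X $ i $ l * c l)) = c k" for k c
  proof -
    have "(\<Sum>i\<in>UNIV. G $ k $ i * (\<Sum>l\<in>UNIV. F X $ i $ l * c l))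
      = (\<Sum>i\<in>UNIV. \<Sum>l\<in>UNIV. G $ k $ i * F X $ i $ l * c l)"
      by (simp add: sum_distrib_left mult.assoc)
    also have "\<dots> = (\<Sum>l\<in>UNIV. (\<Sum>i\<in>UNIV. G $ k $ i * F X $ i $ l) * c l)"
      by (subst sum.swap) (simp add: sum_distrib_right)
    also have "\<dots> = (\<Sum>l\<in>UNIV. if l = k then c l else 0)"
      unfolding GF by (rule sum.cong) auto
    finally show ?thesis by simp
  qed
  \<comment> \<open>Chain rule: differentiation in x_i is differentiation in X_k contracted with
    \<open>G $ k $ i\<close>.\<close>
  have "(\<Sum>i\<in>UNIV. partial i (\<lambda>y. b (\<psi> y) $ i) x)
      = (\<Sum>i\<in>UNIV. \<Sum>k\<in>UNIV. G $ k $ i * db i (axis k 1))"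
    by (simp add: partial_compose[OF diff_b \<psi>(1)] \<psi>(2) partial_eqI[OF db]
        matrix_vector_mul_component inner_axis)
  also have "\<dots> = (\<Sum>k\<in>UNIV. \<Sum>i\<in>UNIV. G $ k $ i * db i (axis k 1))"
    by (rule sum.swap)
  also have "\<dots> = inverse (det (F X)) * (\<Sum>k\<in>UNIV.
      (\<Sum>i\<in>UNIV. G $ k $ i * (\<Sum>l\<in>UNIV. F X $ i $ l * da l (axis k 1)))
      + (\<Sum>i\<in>UNIV. G $ k $ i * (\<Sum>l\<in>UNIV. dF i l (axis k 1) * a X $ l))
      - (\<Sum>i\<in>UNIV. G $ k $ i * (\<Sum>l\<in>UNIV. F X $ i $ l * a X $ l)) * tr (axis k 1))"
    unfolding Gdb collect by (simp only: sum_distrib_left)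
  also have "\<dots> = inverse (det (F X)) * ((\<Sum>k\<in>UNIV. da k (axis k 1))
      + (\<Sum>k\<in>UNIV. \<Sum>i\<in>UNIV. G $ k $ i * (\<Sum>l\<in>UNIV. dF i l (axis k 1) * a X $ l))
      - (\<Sum>k\<in>UNIV. a X $ k * tr (axis k 1)))"
    unfolding contract by (simp add: sum.distrib sum_subtractf)
  \<comment> \<open>Exchanging \<open>k\<close> and \<open>l\<close> by symmetry of second
    derivatives turns this middle sum into the one with \<open>tr\<close>, and the two
    cancel.\<close>
  also have "(\<Sum>k\<in>UNIV. \<Sum>i\<in>UNIV. G $ k $ i * (\<Sum>l\<in>UNIV. dF i l (axis k 1) * a X $ l))
      = (\<Sum>k\<in>UNIV. \<Sum>i\<in>UNIV. \<Sum>l\<in>UNIV. a X $ l * (G $ k $ i * dF i k (axis l 1)))"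
    by (simp only: sum_distrib_left swap)
  also have "\<dots> = (\<Sum>k\<in>UNIV. \<Sum>l\<in>UNIV. \<Sum>i\<in>UNIV. a X $ l * (G $ k $ i * dF i k (axis l 1)))"
    by (rule sum.cong[OF refl], rule sum.swap)
  also have "\<dots> = (\<Sum>l\<in>UNIV. a X $ l * tr (axis l 1))"
    by (subst sum.swap) (simp add: tr_def sum_distrib_left)
  finally show "(\<Sum>i\<in>UNIV. partial i (\<lambda>y. b (\<psi> y) $ i) x)
      = (1 / det (F X)) * (\<Sum>k\<in>UNIV. partial k (\<lambda>Y. a Y $ k) X)"
    by (simp add: partial_eqI[OF da] divide_inverse)
qed

section \<open>Product rules for divergence-free tensor fields\<close>

text \<open>The product rule leaves, besides the contraction of \<open>S\<close> with the gradient,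
  only the inner product of \<open>tensor_div S x\<close> with \<open>w x\<close>.\<close>

lemma ddot_vgrad_divergence_free:
  assumes S: "\<And>i j. (\<lambda>y. S y $ i $ j) differentiable (at x)"
    and w: "\<And>j. (\<lambda>y. w y $ j) differentiable (at x)"
    and div: "tensor_div S x = 0"
  shows "ddot (S x) (vgrad w x) = (\<Sum>i\<in>UNIV. partial i (\<lambda>y. (S y *v w y) $ i) x)"
proof -
  have "(\<Sum>i\<in>UNIV. partial i (\<lambda>y. (S y *v w y) $ i) x)
      = (\<Sum>i\<in>UNIV. \<Sum>j\<in>UNIV. S x $ i $ j * partial i (\<lambda>y. w y $ j) x
          + partial i (\<lambda>y. S y $ i $ j) x * w x $ j)"
    by (simp add: matrix_vector_mult_def partial_sum partial_mult S w)
  also have "\<dots> = ddot (S x) (vgrad w x)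
      + (\<Sum>i\<in>UNIV. \<Sum>j\<in>UNIV. partial i (\<lambda>y. S y $ i $ j) x * w x $ j)"
    by (simp add: ddot_def vgrad_def sum.distrib)
  also have "(\<Sum>i\<in>UNIV. \<Sum>j\<in>UNIV. partial i (\<lambda>y. S y $ i $ j) x * w x $ j)
      = (\<Sum>j\<in>UNIV. tensor_div S x $ j * w x $ j)"
    by (subst sum.swap) (simp add: tensor_div_def sum_distrib_right)
  finally show ?thesis by (simp add: div)
qed

text \<open>As \<open>tensor_div\<close> contracts the first index, the product rule yields the
  transpose of \<open>S x\<close> applied to the gradient; symmetry removes the transpose.\<close>

lemma tensor_div_scaleR_divergence_free:
  assumes S: "\<And>i j. (\<lambda>y. S y $ i $ j) differentiable (at x)"
    and f: "f differentiable (at x)"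
    and "symmetric_tensor (S x)"
    and div: "tensor_div S x = 0"
  shows "tensor_div (\<lambda>y. f y *\<^sub>R S y) x = S x *v grad f x"
proof -
  have div0: "(\<Sum>i\<in>UNIV. partial i (\<lambda>y. S y $ i $ j) x) = 0" for j
    using arg_cong[OF div, of "\<lambda>u. u $ j"] by (simp add: tensor_div_def)
  have "tensor_div (\<lambda>y. f y *\<^sub>R S y) x $ j = (transpose (S x) *v grad f x) $ j" for j
    by (simp add: tensor_div_def partial_mult S f sum.distrib grad_def matrix_vector_mult_def
        transpose_def div0 mult.commute[of "partial _ f x"] flip: sum_distrib_left)
  then show ?thesis
    using assms(3) unfolding vec_eq_iff by (auto simp only: symmetric_tensor_def)
qed

section \<open>Pentamode materials\<close>

lemma invertible_matrix_inv:
  assumes "invertible A"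
  shows "A ** matrix_inv A = mat 1" "matrix_inv A ** A = mat 1"
proof -
  have "\<exists>B. A ** B = mat 1 \<and> B ** A = mat 1"
    using assms by (simp add: invertible_def)
  from someI_ex[OF this] show "A ** matrix_inv A = mat 1" "matrix_inv A ** A = mat 1"
    by (simp_all add: matrix_inv_def)
qed

lemma symmetric_tensor_matrix_inv:
  assumes "symmetric_tensor N" "invertible N"
  shows "symmetric_tensor (matrix_inv N)"
proof -
  have "transpose (matrix_inv N) ** N = transpose (N ** matrix_inv N)"
    using assms(1) by (simp add: symmetric_tensor_def matrix_transpose_mul)
  also have "\<dots> = mat 1"
    using invertible_matrix_inv[OF assms(2)] by (simp add: transpose_mat)
  finally have "transpose (matrix_inv N) ** (N ** matrix_inv N) = matrix_inv N"
    by (simp add: matrix_mul_assoc)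
  then show ?thesis
    using invertible_matrix_inv[OF assms(2)] by (simp add: symmetric_tensor_def)
qed

text \<open>Applied with \<open>c\<close> the Jacobian determinant and \<open>N\<close> the tensor F
  F^t. The outer factors \<open>S\<close> cancel by injectivity in the linear system for
  \<open>w\<close>, so no formula for the inverse of a triple product is involved.\<close>

lemma inertia_tensor:
  fixes S N :: "real^'n^'n"
  assumes S: "invertible S" and N: "invertible N" and "c \<noteq> 0"
    and R: "R = c *\<^sub>R (S ** matrix_inv N ** S)"
  shows "invertible R"
    and "S *v (matrix_inv R *v (S *v g)) = (1 / c) *\<^sub>R (N *v g)"
proof -
  have "invertible (matrix_inv N)"
    using invertible_matrix_inv[OF N] by (auto simp: invertible_def)
  then show inv: "invertible R"
    unfolding R by (intro scalar_invertible invertible_mult S \<open>c \<noteq> 0\<close>)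
  define w where "w = matrix_inv R *v (S *v g)"
  have "R *v w = S *v g"
    using invertible_matrix_inv[OF inv] by (simp add: w_def matrix_vector_mul_assoc matrix_mul_assoc)
  then have "S *v (c *\<^sub>R (matrix_inv N *v (S *v w))) = S *v g"
    by (simp add: R matrix_vector_mul_assoc matrix_vector_mult_scaleR scaleR_matrix_vector_assoc
        matrix_scalar_ac scalar_matrix_assoc matrix_mul_assoc)
  then have "c *\<^sub>R (matrix_inv N *v (S *v w)) = g"
    using inj_matrix_vector_mult[OF S] by (simp add: inj_eq)
  then have "N *v g = c *\<^sub>R ((N ** matrix_inv N) *v (S *v w))"
    by (auto simp: matrix_vector_mult_scaleR simp flip: matrix_vector_mul_assoc)
  then have "N *v g = c *\<^sub>R (S *v w)"
    using invertible_matrix_inv[OF N] by simp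
  then show "S *v (matrix_inv R *v (S *v g)) = (1 / c) *\<^sub>R (N *v g)"
    using \<open>c \<noteq> 0\<close> by (simp add: w_def)
qed

lemma symmetric_tensor_inertia:
  fixes S N :: "real^'n^'n"
  assumes "symmetric_tensor S" "symmetric_tensor N" "invertible N"
  shows "symmetric_tensor (c *\<^sub>R (S ** matrix_inv N ** S))"
  using assms(1) symmetric_tensor_matrix_inv[OF assms(2,3)]
  by (simp add: symmetric_tensor_def transpose_scalar matrix_transpose_mul matrix_mul_assoc)

text \<open>The equivalence of the two wave equations reduces to this identity at each point, with
  \<open>f\<close> and \<open>h\<close> the pressure at a fixed time in the two coordinate
  systems.\<close>

lemma pentamode_operator_eq_laplacian:
  fixes \<phi> \<psi> :: "real^'n \<Rightarrow> real^'n"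
  assumes "open U" "open W" "smooth_on U \<phi>" "smooth_on W \<psi>"
    and \<phi>: "\<And>Y. Y \<in> U \<Longrightarrow> \<phi> Y \<in> W \<and> \<psi> (\<phi> Y) = Y"
    and \<psi>: "\<And>y. y \<in> W \<Longrightarrow> \<psi> y \<in> U \<and> \<phi> (\<psi> y) = y"
    and F: "\<And>Y. Y \<in> U \<Longrightarrow> F Y = jacobian \<phi> (at Y)"
    and J: "\<And>Y. Y \<in> U \<Longrightarrow> det (F Y) \<noteq> 0"
    and S: "\<And>y i j. y \<in> W \<Longrightarrow> (\<lambda>y. S y $ i $ j) differentiable (at y)"
    and S_inv: "\<And>y. y \<in> W \<Longrightarrow> invertible (S y)"
    and div: "\<And>y. y \<in> W \<Longrightarrow> tensor_div S y = 0"
    and \<rho>: "\<And>Y. Y \<in> U \<Longrightarrow>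
      \<rho> (\<phi> Y) = det (F Y) *\<^sub>R (S (\<phi> Y) ** matrix_inv (F Y ** transpose (F Y)) ** S (\<phi> Y))"
    and f: "\<And>Y. Y \<in> U \<Longrightarrow> f differentiable (at Y)"
    and df: "\<And>Y k. Y \<in> U \<Longrightarrow> partial k f differentiable (at Y)"
    and h: "\<And>Y. Y \<in> U \<Longrightarrow> h (\<phi> Y) = f Y"
    and "X \<in> U"
  shows "det (F X) * ddot (S (\<phi> X)) (vgrad (\<lambda>y. matrix_inv (\<rho> y) *v (S y *v grad h y)) (\<phi> X))
    = laplacian f X"
proof -
  define G where "G y = jacobian \<psi> (at y)" for y
  have \<psi>': "(\<psi> has_derivative (\<lambda>k. G y *v k)) (at y)" if "y \<in> W" for y
    using smooth_on_imp_has_derivative[OF assms(4) that] unfolding G_def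
    by (auto simp: differentiable_def simp flip: jacobian_works)
  \<comment> \<open>Obtained by differentiating the relation \<open>\<psi> (\<phi> Y) = Y\<close> on
    the open set \<open>U\<close>.\<close>
  have GF: "G (\<phi> Y) ** F Y = mat 1" if "Y \<in> U" for Y
  proof -
    have "(\<phi> has_derivative (\<lambda>k. F Y *v k)) (at Y)"
      using smooth_on_imp_has_derivative[OF assms(3) that] unfolding F[OF that]
      by (auto simp: differentiable_def simp flip: jacobian_works)
    then have "((\<lambda>Y. \<psi> (\<phi> Y)) has_derivative (\<lambda>k. G (\<phi> Y) *v (F Y *v k))) (at Y)"
      by (rule has_derivative_compose) (use \<psi>' \<phi> that in blast)
    then have "((\<lambda>Y. Y) has_derivative (\<lambda>k. G (\<phi> Y) *v (F Y *v k))) (at Y)"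
      by (rule has_derivative_transform_within_open[OF _ \<open>open U\<close> that]) (simp add: \<phi>)
    then have "(\<lambda>k. G (\<phi> Y) *v (F Y *v k)) = (\<lambda>k. k)"
      by (rule has_derivative_unique) (rule has_derivative_ident)
    then show ?thesis
      by (simp add: matrix_eq matrix_vector_mul_assoc fun_eq_iff)
  qed
  have grad_h: "grad h (\<phi> Y) = transpose (G (\<phi> Y)) *v grad f Y" if "Y \<in> U" for Y
  proof -
    have "partial l h (\<phi> Y) = partial l (\<lambda>y. f (\<psi> y)) (\<phi> Y)" for l
      by (rule partial_cong[OF \<open>open W\<close>]) (use \<phi> \<psi> that h in \<open>auto, metis\<close>)
    moreover have "partial l (\<lambda>y. f (\<psi> y)) (\<phi> Y)
        = (\<Sum>k\<in>UNIV. (G (\<phi> Y) *v axis l 1) $ k * partial k f Y)" for l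
      using partial_compose[of f \<psi> "\<phi> Y"] \<phi>[OF that] f[OF that] \<psi>' by simp
    ultimately show ?thesis
      by (simp add: vec_eq_iff grad_def vector_matrix_mult_def matrix_vector_mul_component
          inner_axis mult.commute)
  qed
  define w where "w y = matrix_inv (\<rho> y) *v (S y *v grad h y)" for y
  define b where "b Y = (1 / det (F Y)) *\<^sub>R (F Y *v grad f Y)" for Y
  have Sw: "S (\<phi> Y) *v w (\<phi> Y) = b Y" if "Y \<in> U" for Y
  proof -
    have inv: "invertible (F Y ** transpose (F Y))"
      using J[OF that] by (simp add: invertible_det_nz det_mul det_transpose)
    \<comment> \<open>The transposed \<open>F\<close> undoes the chain rule factor in
      \<open>grad_h\<close>.\<close>
    have "transpose (F Y) *v grad h (\<phi> Y) = transpose (G (\<phi> Y) ** F Y) *v grad f Y"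
      unfolding grad_h[OF that] matrix_vector_mul_assoc matrix_transpose_mul ..
    then have "transpose (F Y) *v grad h (\<phi> Y) = grad f Y"
      unfolding GF[OF that] by (simp add: transpose_mat)
    then have "(F Y ** transpose (F Y)) *v grad h (\<phi> Y) = F Y *v grad f Y"
      unfolding matrix_vector_mul_assoc[symmetric] by (rule arg_cong)
    then show ?thesis
      unfolding w_def b_def
      using inertia_tensor(2)[OF S_inv inv J \<rho>] \<phi> that by metis
  qed
  have Sw': "S y *v w y = b (\<psi> y)" if "y \<in> W" for y
    using Sw[of "\<psi> y"] \<psi>[OF that] by simp
  have X: "\<phi> X \<in> W" "\<psi> (\<phi> X) = X" using \<phi> \<open>X \<in> U\<close> by auto
  have FG: "F X ** G (\<phi> X) = mat 1"
    using GF[OF \<open>X \<in> U\<close>] by (simp add: matrix_left_right_inverse)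
  have dgrad: "(\<lambda>Y. grad f Y $ k) differentiable (at X)" for k
    using df[OF \<open>X \<in> U\<close>] by (simp add: grad_def)
  have piola: "(\<lambda>y. b (\<psi> y) $ i) differentiable (at (\<phi> X))"
    "(\<Sum>i\<in>UNIV. partial i (\<lambda>y. b (\<psi> y) $ i) (\<phi> X))
      = (1 / det (F X)) * (\<Sum>k\<in>UNIV. partial k (\<lambda>Y. grad f Y $ k) X)" for i
    unfolding b_def
    by (rule piola_transform_divergence[OF \<open>open U\<close> \<open>X \<in> U\<close> assms(3) F J[OF \<open>X \<in> U\<close>] FG
          \<psi>'[OF X(1)] X(2) dgrad]; assumption)+
  \<comment> \<open>Here \<open>w\<close> is the solution of a system with matrix \<open>S\<close>
    and right-hand side \<open>b (\<psi> y)\<close>, both differentiable;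
    \<open>matrix_inv (\<rho> y)\<close> is never differentiated.\<close>
  have w: "(\<lambda>y. w y $ j) differentiable (at (\<phi> X))" for j
    by (rule differentiable_solution[OF \<open>open W\<close> X(1) S[OF X(1)] piola(1) S_inv Sw'])
  have "ddot (S (\<phi> X)) (vgrad w (\<phi> X)) = (\<Sum>i\<in>UNIV. partial i (\<lambda>y. (S y *v w y) $ i) (\<phi> X))"
    by (rule ddot_vgrad_divergence_free[OF S[OF X(1)] w div[OF X(1)]])
  also have "\<dots> = (\<Sum>i\<in>UNIV. partial i (\<lambda>y. b (\<psi> y) $ i) (\<phi> X))"
    by (intro sum.cong refl partial_cong[OF \<open>open W\<close> X(1)]) (simp add: Sw')
  also have "\<dots> = (1 / det (F X)) * laplacian f X"
    unfolding piola(2) by (simp add: laplacian_def grad_def)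
  finally show ?thesis
    using J[OF \<open>X \<in> U\<close>] unfolding w_def by simp
qed

section \<open>Exchange of time and space derivatives\<close>

lemma has_derivative_Pair_slices:
  assumes "(P has_derivative P') (at (x, t))"
  shows "((\<lambda>y. P (y, t)) has_derivative (\<lambda>k. P' (k, 0))) (at x)"
    and "((\<lambda>s. P (x, s)) has_derivative (\<lambda>k. P' (0, k))) (at t)"
  by (rule has_derivative_compose[where f = "\<lambda>y. (y, t)" and g = P, OF _ assms]
        has_derivative_compose[where f = "\<lambda>s. (x, s)" and g = P, OF _ assms],
      auto intro!: derivative_eq_intros)+

text \<open>Joint smoothness makes both orders of differentiation mixed second derivatives of one
  map on space-time, hence equal.\<close>

lemma has_derivative_ddot_vgrad:
  fixes v :: "real^'n \<Rightarrow> real \<Rightarrow> real^'n"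
  assumes "open W" "open T" "x \<in> W" "t \<in> T" and v: "smooth_on (W \<times> T) (\<lambda>(x, t). v x t)"
  shows "((\<lambda>s. ddot A (vgrad (\<lambda>y. v y s) x)) has_real_derivative
      ddot A (vgrad (\<lambda>y. vector_derivative (v y) (at t)) x)) (at t)"
    and "(\<lambda>y. vector_derivative (v y) (at t) $ j) differentiable (at x)"
proof -
  let ?P = "\<lambda>(x, t). v x t"
  \<comment> \<open>Space-time directional derivative: \<open>(axis i 1, 0)\<close> is a spatial
    direction and \<open>(0, 1)\<close> is the time direction.\<close>
  define D where "D u z = frechet_derivative ?P (at z) u" for u z
  define D2 where "D2 u z = frechet_derivative (D u) (at z)" for u z
  have P: "(?P has_derivative (\<lambda>u. D u z)) (at z)" if "z \<in> W \<times> T" for z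
    unfolding D_def by (rule smooth_on_imp_has_derivative[OF v that])
  have D: "(D u has_derivative D2 u z) (at z)" if "z \<in> W \<times> T" for u z
    unfolding D2_def D_def
    by (rule smooth_on_imp_has_derivative[OF smooth_on_frechet_derivative[OF v] that])
  have sym: "D2 u (x, t) k = D2 k (x, t) u" for u k
    unfolding D2_def D_def
    by (rule smooth_on_frechet_derivative_commute[OF _ _ v]) (use assms in \<open>auto intro: open_Times\<close>)
  have vt: "vector_derivative (v y) (at t) = D (0, 1) (y, t)" if "y \<in> W" for y
  proof -
    have d: "(v y has_derivative (\<lambda>k. D (0, k) (y, t))) (at t)"
      using has_derivative_Pair_slices(2)[OF P, of y t] that \<open>t \<in> T\<close> by simp
    have "(\<lambda>k. D (0, k) (y, t)) = (\<lambda>k. k *\<^sub>R D (0, 1) (y, t))"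
    proof
      fix k show "D (0, k) (y, t) = k *\<^sub>R D (0, 1) (y, t)"
        using linear_cmul[OF has_derivative_linear[OF d], of k 1] by simp
    qed
    with d show ?thesis
      by (intro vector_derivative_at) (simp only: has_vector_derivative_def)
  qed
  have vt': "((\<lambda>y. vector_derivative (v y) (at t) $ j) has_derivative
      (\<lambda>k. D2 (0, 1) (x, t) (k, 0) $ j)) (at x)" for j
    by (rule has_derivative_transform_within_open[OF has_derivative_vec_nth[OF
            has_derivative_Pair_slices(1)[OF D]] \<open>open W\<close> \<open>x \<in> W\<close>])
      (use assms vt in auto)
  then show "(\<lambda>y. vector_derivative (v y) (at t) $ j) differentiable (at x)"
    by (rule differentiableI)
  have vx: "partial i (\<lambda>y. v y s $ j) x = D (axis i 1, 0) (x, s) $ j" if "s \<in> T" for i j s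
    using has_derivative_vec_nth[OF has_derivative_Pair_slices(1)[OF P, of x s]] that \<open>x \<in> W\<close>
    by (intro partial_eqI) simp
  have vxt: "((\<lambda>s. D (axis i 1, 0) (x, s) $ j) has_real_derivative D2 (axis i 1, 0) (x, t) (0, 1) $ j) (at t)"
    for i j
  proof -
    have d: "((\<lambda>s. D (axis i 1, 0) (x, s) $ j) has_derivative
        (\<lambda>k. D2 (axis i 1, 0) (x, t) (0, k) $ j)) (at t)"
      by (rule has_derivative_vec_nth[OF has_derivative_Pair_slices(2)[OF D]]) (use assms in auto)
    have "(\<lambda>k. D2 (axis i 1, 0) (x, t) (0, k) $ j)
        = (\<lambda>k. D2 (axis i 1, 0) (x, t) (0, 1) $ j * k)"
    proof
      fix k show "D2 (axis i 1, 0) (x, t) (0, k) $ j = D2 (axis i 1, 0) (x, t) (0, 1) $ j * k"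
        using linear_cmul[OF has_derivative_linear[OF d], of k 1] by (simp add: mult.commute)
    qed
    with d show ?thesis by (simp only: has_field_derivative_def)
  qed
  have "((\<lambda>s. \<Sum>i\<in>UNIV. \<Sum>j\<in>UNIV. A $ i $ j * D (axis i 1, 0) (x, s) $ j) has_real_derivative
      (\<Sum>i\<in>UNIV. \<Sum>j\<in>UNIV. A $ i $ j * D2 (axis i 1, 0) (x, t) (0, 1) $ j)) (at t)"
    by (intro DERIV_sum DERIV_cmult vxt)
  then have "((\<lambda>s. ddot A (vgrad (\<lambda>y. v y s) x)) has_real_derivative
      (\<Sum>i\<in>UNIV. \<Sum>j\<in>UNIV. A $ i $ j * D2 (axis i 1, 0) (x, t) (0, 1) $ j)) (at t)"
    by (rule has_field_derivative_transform_within_open[OF _ \<open>open T\<close> \<open>t \<in> T\<close>])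
      (simp add: ddot_def vgrad_def vx)
  moreover have "(\<Sum>i\<in>UNIV. \<Sum>j\<in>UNIV. A $ i $ j * D2 (axis i 1, 0) (x, t) (0, 1) $ j)
      = ddot A (vgrad (\<lambda>y. vector_derivative (v y) (at t)) x)"
    by (simp add: ddot_def vgrad_def partial_eqI[OF vt'] sym[of "(0, 1)"])
  ultimately show "((\<lambda>s. ddot A (vgrad (\<lambda>y. v y s) x)) has_real_derivative
      ddot A (vgrad (\<lambda>y. vector_derivative (v y) (at t)) x)) (at t)" by simp
qed

text \<open>A rank-one stiffness returns a multiple of \<open>S\<close>. The coefficient is a full
  contraction, which is a trace because the strain is symmetric.\<close>

lemma stress_pentamode:
  assumes "symmetric_tensor E"
  shows "stress (k *\<^sub>R tensor_prod S S) E = (k * trace (S ** E)) *\<^sub>R S"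
proof -
  have "transpose E $ j $ i = E $ j $ i" for i j
    using assms by (simp only: symmetric_tensor_def)
  then have sym: "E $ i $ j = E $ j $ i" for i j by (simp add: transpose_def)
  have "trace (S ** E) = (\<Sum>i\<in>UNIV. \<Sum>j\<in>UNIV. S $ i $ j * E $ j $ i)"
    by (simp add: trace_def matrix_matrix_mult_def)
  also have "\<dots> = (\<Sum>i\<in>UNIV. \<Sum>j\<in>UNIV. S $ i $ j * E $ i $ j)"
    by (intro sum.cong refl arg_cong2[where f = times] sym)
  finally show ?thesis
    by (simp add: vec_eq_iff stress_def tensor_prod_def sum_distrib_left sum_distrib_right mult_ac)
qed

text \<open>Here \<open>q\<close> is \<open>p\<close> read in the coordinates of \<omega>. The
  conjuncts after the equivalence justify the name pseudo-pressure equation: the material is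
  admissible, the reduced and general forms agree, and motions with smooth velocity obey
  them.\<close>

theorem theorem1:
  fixes \<Omega> \<omega> :: "(real^'n) set" and origin :: "real^'n" and map\<chi> :: "real^'n \<Rightarrow> real^'n"
    and F V :: "real^'n \<Rightarrow> real^'n^'n" and J :: "real^'n \<Rightarrow> real"
    and S \<rho> :: "real^'n \<Rightarrow> real^'n^'n" and K :: "real^'n \<Rightarrow> real"
    and C :: "real^'n \<Rightarrow> real^'n^'n^'n^'n"
    and T :: "real set" and p q :: "real^'n \<Rightarrow> real \<Rightarrow> real"
  assumes "open \<Omega>" "connected \<Omega>" "open \<omega>" "connected \<omega>" "origin \<in> \<Omega>"
    and "bij_betw map\<chi> (\<Omega> - {origin}) \<omega>"
    and "smooth_on (\<Omega> - {origin}) map\<chi>"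
    and "smooth_on \<omega> (inv_into (\<Omega> - {origin}) map\<chi>)"
    and F: "\<forall>X\<in>\<Omega> - {origin}. F X = jacobian map\<chi> (at X)"
    and J: "\<forall>X\<in>\<Omega> - {origin}. J X = det (F X) \<and> J X > 0"
    and V: "\<forall>X\<in>\<Omega> - {origin}. posdef_symmetric (V X) \<and> V X ** V X = F X ** transpose (F X)"
    and "smooth_on \<omega> S"
    and "\<forall>x\<in>\<omega>. symmetric_tensor (S x) \<and> invertible (S x)"
    and "\<forall>x\<in>\<omega>. tensor_div S x = 0"
    and K: "\<forall>X\<in>\<Omega> - {origin}. K (map\<chi> X) = J X"
    and C: "\<forall>x\<in>\<omega>. C x = K x *\<^sub>R tensor_prod (S x) (S x)"
    and \<rho>: "\<forall>X\<in>\<Omega> - {origin}.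
      \<rho> (map\<chi> X) = J X *\<^sub>R (S (map\<chi> X) ** matrix_inv (V X ** V X) ** S (map\<chi> X))"
    and "open T" "is_interval T"
    and "smooth_on ((\<Omega> - {origin}) \<times> T) (\<lambda>(X, t). p X t)"
    and q: "\<forall>X\<in>\<Omega> - {origin}. \<forall>t\<in>T. q (map\<chi> X) t = p X t"
  shows "(uniform_wave_eq (\<Omega> - {origin}) T p \<longleftrightarrow> reduced_pseudo_pressure_eq \<omega> T K S \<rho> q) \<and>
    pentamode_material \<omega> C \<rho> K S \<and>
    (reduced_pseudo_pressure_eq \<omega> T K S \<rho> q \<longleftrightarrow> pseudo_pressure_eq \<omega> T K S \<rho> q) \<and>
    (\<forall>\<epsilon> v. smooth_on (\<omega> \<times> T) (\<lambda>(x, t). v x t) \<and> pentamode_motion \<omega> T C \<rho> K S \<epsilon> v q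
       \<longrightarrow> reduced_pseudo_pressure_eq \<omega> T K S \<rho> q)"
proof -
  define U where "U = \<Omega> - {origin}"
  define \<psi> where "\<psi> = inv_into U map\<chi>"
  \<comment> \<open>Cited by position below: 6 to 8 concern the map and its inverse, 9 to 11
    \<open>F\<close>, \<open>J\<close>, \<open>V\<close>, 12 to 14 \<open>S\<close>, 15 to 17
    \<open>K\<close>, \<open>C\<close>, \<open>\<rho>\<close>, and 20 and 21 \<open>p\<close> and
    \<open>q\<close>.\<close>
  note chi = assms[folded U_def, folded \<psi>_def]
  have openU: "open U" unfolding U_def using \<open>open \<Omega>\<close> by (rule open_delete)
  have \<chi>: "map\<chi> Y \<in> \<omega> \<and> \<psi> (map\<chi> Y) = Y" if "Y \<in> U" for Y
    using chi(6) that unfolding \<psi>_def bij_betw_def by auto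
  have \<psi>: "\<psi> y \<in> U \<and> map\<chi> (\<psi> y) = y" if "y \<in> \<omega>" for y
    using chi(6) that unfolding \<psi>_def bij_betw_def by (metis f_inv_into_f inv_into_into)
  have FJ: "F Y = jacobian map\<chi> (at Y)" "J Y = det (F Y)" "0 < det (F Y)" "K (map\<chi> Y) = det (F Y)"
    if "Y \<in> U" for Y
    using chi(9,10,15) that by auto
  have symS: "symmetric_tensor (S y)" and invS: "invertible (S y)" and divS: "tensor_div S y = 0"
    if "y \<in> \<omega>" for y
    using chi(13,14) that by auto
  have diffS: "(\<lambda>y. S y $ i $ j) differentiable (at y)" if "y \<in> \<omega>" for y i j
    by (rule differentiableI[OF has_derivative_vec_nth[OF has_derivative_vec_nth[OF
            smooth_on_imp_has_derivative[OF chi(12) that]]]])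
  have rho: "\<rho> (map\<chi> Y)
      = det (F Y) *\<^sub>R (S (map\<chi> Y) ** matrix_inv (F Y ** transpose (F Y)) ** S (map\<chi> Y))"
    if "Y \<in> U" for Y
    using chi(17,11) that FJ(2) by auto
  have pent: "0 < K y \<and> symmetric_tensor (\<rho> y) \<and> invertible (\<rho> y)" if y: "y \<in> \<omega>" for y
  proof -
    obtain Y where Y: "Y \<in> U" "y = map\<chi> Y" using \<psi>[OF y] by metis
    have "invertible (F Y ** transpose (F Y))"
      using FJ(3)[OF Y(1)] by (simp add: invertible_det_nz det_mul det_transpose)
    moreover have "symmetric_tensor (F Y ** transpose (F Y))"
      by (simp add: symmetric_tensor_def matrix_transpose_mul)
    moreover have "det (F Y) \<noteq> 0" using FJ(3)[OF Y(1)] by simp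
    ultimately show ?thesis
      using FJ(3,4)[OF Y(1)] symmetric_tensor_inertia[OF symS] inertia_tensor(1)[OF invS]
        rho[OF Y(1)] y unfolding Y(2) by metis
  qed
  let ?P = "\<lambda>(X, t). p X t"
  have f: "((\<lambda>Y. p Y t) has_derivative (\<lambda>k. frechet_derivative ?P (at (Y, t)) (k, 0))) (at Y)"
    if "Y \<in> U" "t \<in> T" for Y t
    using has_derivative_Pair_slices(1)[OF smooth_on_imp_has_derivative[OF chi(20)], of Y t] that
    by simp
  \<comment> \<open>Near \<open>Y\<close> this partial derivative is a slice of the space-time
    derivative of \<open>p\<close> in direction \<open>(axis k 1, 0)\<close>, which is
    smooth.\<close>
  have df: "partial k (\<lambda>Y. p Y t) differentiable (at Y)" if "Y \<in> U" "t \<in> T" for Y t k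
  proof -
    let ?D = "\<lambda>z. frechet_derivative ?P (at z) (axis k 1, 0)"
    have "(\<lambda>Y. ?D (Y, t)) differentiable (at Y)"
      by (rule differentiableI[OF has_derivative_Pair_slices(1)[OF
              smooth_on_imp_has_derivative[OF smooth_on_frechet_derivative[OF chi(20)]]]])
        (use that in auto)
    then show ?thesis
      using that partial_eqI[OF f] openU unfolding differentiable_def
      by (metis (no_types, lifting) has_derivative_transform_within_open)
  qed
  have h: "q (map\<chi> Y) t = p Y t" if "Y \<in> U" "t \<in> T" for Y t
    using chi(21) that by auto
  let ?w = "\<lambda>t y. matrix_inv (\<rho> y) *v (S y *v grad (\<lambda>z. q z t) y)"
  have operator: "K (map\<chi> Y) * ddot (S (map\<chi> Y)) (vgrad (?w t) (map\<chi> Y)) = laplacian (\<lambda>Z. p Z t) Y"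
    if "Y \<in> U" "t \<in> T" for Y t
    unfolding FJ(4)[OF that(1)]
  proof (rule pentamode_operator_eq_laplacian[OF openU \<open>open \<omega>\<close> chi(7,8) \<chi> \<psi> FJ(1) _
        diffS invS divS rho _ _ _ that(1)])
    show "det (F Z) \<noteq> 0" if "Z \<in> U" for Z using FJ(3)[OF that] by simp
  qed (use that h df differentiableI[OF f] in auto)
  \<comment> \<open>The two functions agree only for times in the open set \<open>T\<close>, so the
    passage to derivatives goes through neighbourhoods, once for each order.\<close>
  have ddt: "deriv (deriv (q (map\<chi> Y))) t = deriv (deriv (p Y)) t" if "Y \<in> U" "t \<in> T" for Y t
  proof -
    have "eventually (\<lambda>s. q (map\<chi> Y) s = p Y s) (nhds s)" if "s \<in> T" for s
      using eventually_nhds_in_open[OF \<open>open T\<close> that] by eventually_elim (rule h[OF \<open>Y \<in> U\<close>])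
    then have "deriv (q (map\<chi> Y)) s = deriv (p Y) s" if "s \<in> T" for s
      using that by (intro deriv_cong_ev refl)
    then have "eventually (\<lambda>s. deriv (q (map\<chi> Y)) s = deriv (p Y) s) (nhds t)"
      using eventually_nhds_in_open[OF \<open>open T\<close> \<open>t \<in> T\<close>] by (auto elim: eventually_mono)
    then show ?thesis by (intro deriv_cong_ev refl)
  qed
  have \<omega>: "\<omega> = map\<chi> ` U" using \<chi> \<psi> by force
  have wave: "uniform_wave_eq U T p \<longleftrightarrow> reduced_pseudo_pressure_eq \<omega> T K S \<rho> q"
    unfolding uniform_wave_eq_def reduced_pseudo_pressure_eq_def \<omega> ball_simps
    by (simp add: operator ddt)
  \<comment> \<open>Inherited from \<open>p\<close>, since \<open>q z t = p (\<psi> z) t\<close> on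
    \<omega>.\<close>
  have dq: "(\<lambda>z. q z t) differentiable (at y)" if "y \<in> \<omega>" "t \<in> T" for y t
  proof -
    have "(\<lambda>Y. p Y t) differentiable (at (\<psi> y))" "\<psi> differentiable (at y)"
      using f \<psi> that smooth_on_imp_has_derivative[OF chi(8)] unfolding differentiable_def by blast+
    then have "(\<lambda>z. p (\<psi> z) t) differentiable (at y)"
      using differentiable_chain_at[of \<psi> y "\<lambda>Y. p Y t"] by (simp add: o_def)
    moreover have "p (\<psi> z) t = q z t" if "z \<in> \<omega>" for z
      using h \<psi>[OF that] \<open>t \<in> T\<close> by metis
    ultimately show ?thesis
      using \<open>open \<omega>\<close> \<open>y \<in> \<omega>\<close> unfolding differentiable_def
      by (meson has_derivative_transform_within_open)
  qed
  \<comment> \<open>The arguments of the gradients agree on the open set \<omega>, which suffices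
    for equal partial derivatives at \<open>x\<close>.\<close>
  have "vgrad (\<lambda>y. matrix_inv (\<rho> y) *v tensor_div (\<lambda>z. q z t *\<^sub>R S z) y) x = vgrad (?w t) x"
    if "x \<in> \<omega>" "t \<in> T" for x t
    unfolding vgrad_def
    by (intro arg_cong[where f = vec_lambda] ext partial_cong[OF \<open>open \<omega>\<close> that(1)])
      (simp add: tensor_div_scaleR_divergence_free[OF diffS dq symS divS] that(2))
  then have reduced: "reduced_pseudo_pressure_eq \<omega> T K S \<rho> q \<longleftrightarrow> pseudo_pressure_eq \<omega> T K S \<rho> q"
    by (simp add: reduced_pseudo_pressure_eq_def pseudo_pressure_eq_def)
  have motion: "reduced_pseudo_pressure_eq \<omega> T K S \<rho> q"
    if v: "smooth_on (\<omega> \<times> T) (\<lambda>(x, t). v x t)" and m: "pentamode_motion \<omega> T C \<rho> K S \<epsilon> v q" for \<epsilon> v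
    unfolding reduced_pseudo_pressure_eq_def
  proof (intro ballI)
    fix x t assume x: "x \<in> \<omega>" and t: "t \<in> T"
    let ?a = "\<lambda>y. vector_derivative (v y) (at t)"
    have acc: "?w t y = - ?a y" if y: "y \<in> \<omega>" for y
    proof -
      \<comment> \<open>The definition of the pseudo-pressure identifies the coefficient from
        \<open>stress_pentamode\<close> as \<open>- q z t\<close>.\<close>
      have "stress (C z) (\<epsilon> z t) = (- q z t) *\<^sub>R S z" if "z \<in> \<omega>" for z
        using m that t chi(16) by (simp add: pentamode_motion_def stress_pentamode)
      then have "tensor_div (\<lambda>z. stress (C z) (\<epsilon> z t)) y = tensor_div (\<lambda>z. (- q z t) *\<^sub>R S z) y"
        unfolding tensor_div_def
        by (intro arg_cong[where f = vec_lambda] ext sum.cong refl partial_cong[OF \<open>open \<omega>\<close> y]) simp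
      also have "\<dots> = S y *v grad (\<lambda>z. - q z t) y"
        by (intro tensor_div_scaleR_divergence_free diffS symS divS differentiable_minus dq y t)
      also have "grad (\<lambda>z. - q z t) y = - grad (\<lambda>z. q z t) y"
        using dq[OF y t] unfolding frechet_derivative_works
        by (simp add: vec_eq_iff grad_def partial_def[of _ "\<lambda>z. q z t"]
            partial_eqI[OF has_derivative_minus])
      finally have "\<rho> y *v ?a y = S y *v - grad (\<lambda>z. q z t) y"
        using m y t by (simp add: pentamode_motion_def)
      then have "S y *v grad (\<lambda>z. q z t) y = \<rho> y *v - ?a y"
        by (simp add: linear_neg[OF matrix_vector_mul_linear])
      then show ?thesis
        using invertible_matrix_inv(2)[of "\<rho> y"] pent[OF y]
        by (simp add: matrix_vector_mul_assoc)
    qed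
    note dv = has_derivative_ddot_vgrad[OF \<open>open \<omega>\<close> \<open>open T\<close> x t v]
    \<comment> \<open>Moving the sign through \<open>partial\<close> takes differentiability of the
      acceleration, supplied by \<open>dv(2)\<close>.\<close>
    have "partial i (\<lambda>y. ?w t y $ j) x = - partial i (\<lambda>y. ?a y $ j) x" for i j
    proof -
      have "partial i (\<lambda>y. ?w t y $ j) x = partial i (\<lambda>y. - (?a y $ j)) x"
        by (rule partial_cong[OF \<open>open \<omega>\<close> x]) (simp only: acc vector_uminus_component)
      then show ?thesis
        using dv(2)[of j] unfolding frechet_derivative_works
        by (simp add: partial_def[of _ "\<lambda>y. ?a y $ j"] partial_eqI[OF has_derivative_minus])
    qed
    then have wa: "ddot (S x) (vgrad (?w t) x) = - ddot (S x) (vgrad ?a x)"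
      by (simp add: ddot_def vgrad_def sum_negf)
    \<comment> \<open>The rate equation for \<open>q\<close> holds throughout the open set
      \<open>T\<close>, so it may be differentiated once more in time.\<close>
    have "(deriv (q x) has_real_derivative - K x * ddot (S x) (vgrad ?a x)) (at t)"
      by (rule has_field_derivative_transform_within_open[OF DERIV_cmult[OF dv(1)] \<open>open T\<close> t])
        (use m x in \<open>simp add: pentamode_motion_def\<close>)
    then have "deriv (deriv (q x)) t = - K x * ddot (S x) (vgrad ?a x)"
      by (rule DERIV_imp_deriv)
    then show "K x * ddot (S x) (vgrad (?w t) x) - deriv (deriv (q x)) t = 0"
      by (simp add: wa)
  qed
  have "pentamode_material \<omega> C \<rho> K S"
    using pent symS chi(16) by (simp add: pentamode_material_def)
  then show ?thesis
    using wave reduced motion unfolding U_def by blast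
qed

end
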